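(* Let $\theta$ be a capped automorphism of a thick spherical building $\Delta$ of type $(W,S)$, let $J=\mathrm{Type}(\theta)$, and let $C$ be a chamber of $\Delta$. Then $\ell(\delta(C,C^\theta))=\mathrm{disp}(\theta)$ if and only if $\delta(C,C^\theta)=w_{S\setminus J}w_0$. In particular $\mathrm{disp}(\theta)=\ell(w_0)-\ell(w_{S\setminus J})=\mathrm{diam}(W)-\mathrm{diam}(W_{S\setminus J})$.
   Context: $\Delta$ is a simplicial complex with type map into subsets of $S$ and Weyl distance $\delta$ on chambers; $\ell$ is the Coxeter length, $w_0$ the longest element of $W$, and for $K\subseteq S$, $W_K$ is the parabolic subgroup and $w_K$ its longest element; $\mathrm{diam}(W)=\ell(w_0)$, $\mathrm{diam}(W_K)=\ell(w_K)$. Simplices are opposite if every chamber containing either is at Weyl distance $w_0$ from some chamber containing the other. An automorphism is a simplicial automorphism (not necessarily type preserving). $\mathrm{Type}(\theta)$ is the union of all $J\subseteq S$ such that some simplex of type $J$ is opposite its image under $\theta$; $\theta$ is capped if some simplex of type $\mathrm{Type}(\theta)$ is opposite its image. $\mathrm{disp}(\theta)=\max_C \ell(\delta(C,C^\theta))$ over all chambers $C$. *)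

theory Defs
  imports Main
begin

text \<open>The generating set S is the (finite) type 's.  A Coxeter matrix
  M :: 's => 's => nat uses the value 0 for m(s,t) = infinity.\<close>

definition coxeter_matrix :: "('s \<Rightarrow> 's \<Rightarrow> nat) \<Rightarrow> bool" where
  "coxeter_matrix M \<longleftrightarrow> (\<forall>s. M s s = 1) \<and> (\<forall>s t. M s t = M t s)
     \<and> (\<forall>s t. s \<noteq> t \<longrightarrow> M s t \<noteq> 1)"

fun alt_word :: "'s \<Rightarrow> 's \<Rightarrow> nat \<Rightarrow> 's list" where
  "alt_word s t 0 = []"
| "alt_word s t (Suc n) = s # alt_word t s n"

text \<open>The congruence on words generated by the Coxeter relations (s t)^m(s,t) = 1;
  W is the free monoid on S modulo this congruence (= the group with the Coxeter presentation).\<close>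

inductive cox_eq :: "('s \<Rightarrow> 's \<Rightarrow> nat) \<Rightarrow> 's list \<Rightarrow> 's list \<Rightarrow> bool" for M where
  refl: "cox_eq M w w"
| sym: "cox_eq M u v \<Longrightarrow> cox_eq M v u"
| trans: "cox_eq M u v \<Longrightarrow> cox_eq M v w \<Longrightarrow> cox_eq M u w"
| rel: "M s t \<noteq> 0 \<Longrightarrow> cox_eq M (alt_word s t (2 * M s t)) []"
| ctxt: "cox_eq M u v \<Longrightarrow> cox_eq M (x @ u @ y) (x @ v @ y)"

text \<open>Elements of W are equivalence classes of words.\<close>
type_synonym 's cox = "'s list set"

definition cox_class :: "('s \<Rightarrow> 's \<Rightarrow> nat) \<Rightarrow> 's list \<Rightarrow> 's cox" where
  "cox_class M w = {v. cox_eq M w v}"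

definition coxW :: "('s \<Rightarrow> 's \<Rightarrow> nat) \<Rightarrow> 's cox set" where
  "coxW M = range (cox_class M)"

definition cox_rep :: "'s cox \<Rightarrow> 's list" where
  "cox_rep a = (SOME w. w \<in> a)"

definition cox_one :: "('s \<Rightarrow> 's \<Rightarrow> nat) \<Rightarrow> 's cox" where
  "cox_one M = cox_class M []"

definition cox_gen :: "('s \<Rightarrow> 's \<Rightarrow> nat) \<Rightarrow> 's \<Rightarrow> 's cox" where
  "cox_gen M s = cox_class M [s]"

definition cox_mult :: "('s \<Rightarrow> 's \<Rightarrow> nat) \<Rightarrow> 's cox \<Rightarrow> 's cox \<Rightarrow> 's cox" where
  "cox_mult M a b = cox_class M (cox_rep a @ cox_rep b)"

definition cox_len :: "'s cox \<Rightarrow> nat" where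
  "cox_len a = (LEAST n. \<exists>w\<in>a. length w = n)"

definition cox_par :: "('s \<Rightarrow> 's \<Rightarrow> nat) \<Rightarrow> 's set \<Rightarrow> 's cox set" where
  "cox_par M K = {cox_class M w | w. set w \<subseteq> K}"

definition cox_longest :: "('s \<Rightarrow> 's \<Rightarrow> nat) \<Rightarrow> 's set \<Rightarrow> 's cox" where
  "cox_longest M K = (THE w. w \<in> cox_par M K \<and> (\<forall>v\<in>cox_par M K. cox_len v \<le> cox_len w))"

definition cox_map :: "('s \<Rightarrow> 's \<Rightarrow> nat) \<Rightarrow> ('s \<Rightarrow> 's) \<Rightarrow> 's cox \<Rightarrow> 's cox" where
  "cox_map M \<sigma> a = cox_class M (map \<sigma> (cox_rep a))"

section \<open>Buildings as W-metric spaces (Abramenko--Brown, Def. 5.1)\<close>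

definition building ::
  "('s \<Rightarrow> 's \<Rightarrow> nat) \<Rightarrow> 'c set \<Rightarrow> ('c \<Rightarrow> 'c \<Rightarrow> 's cox) \<Rightarrow> bool" where
  "building M Ch \<delta> \<longleftrightarrow> coxeter_matrix M \<and> Ch \<noteq> {}
     \<and> (\<forall>C\<in>Ch. \<forall>D\<in>Ch. \<delta> C D \<in> coxW M)
     \<and> (\<forall>C\<in>Ch. \<forall>D\<in>Ch. \<delta> C D = cox_one M \<longleftrightarrow> C = D)
     \<and> (\<forall>C\<in>Ch. \<forall>D\<in>Ch. \<forall>C'\<in>Ch. \<forall>s. \<delta> C' C = cox_gen M s \<longrightarrow>
          \<delta> C' D \<in> {cox_mult M (cox_gen M s) (\<delta> C D), \<delta> C D}
          \<and> (cox_len (cox_mult M (cox_gen M s) (\<delta> C D)) = cox_len (\<delta> C D) + 1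
               \<longrightarrow> \<delta> C' D = cox_mult M (cox_gen M s) (\<delta> C D)))
     \<and> (\<forall>C\<in>Ch. \<forall>D\<in>Ch. \<forall>s. \<exists>C'\<in>Ch. \<delta> C' C = cox_gen M s
          \<and> \<delta> C' D = cox_mult M (cox_gen M s) (\<delta> C D))"

text \<open>Thick: every panel contains at least three chambers, i.e. every chamber has at least
  two distinct s-adjacent chambers for every s.\<close>
definition thick_building ::
  "('s \<Rightarrow> 's \<Rightarrow> nat) \<Rightarrow> 'c set \<Rightarrow> ('c \<Rightarrow> 'c \<Rightarrow> 's cox) \<Rightarrow> bool" where
  "thick_building M Ch \<delta> \<longleftrightarrow> building M Ch \<delta>
     \<and> (\<forall>C\<in>Ch. \<forall>s. \<exists>D1\<in>Ch. \<exists>D2\<in>Ch. D1 \<noteq> D2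
          \<and> \<delta> C D1 = cox_gen M s \<and> \<delta> C D2 = cox_gen M s)"

definition spherical :: "('s \<Rightarrow> 's \<Rightarrow> nat) \<Rightarrow> bool" where
  "spherical M \<longleftrightarrow> finite (coxW M)"

definition building_aut ::
  "('s \<Rightarrow> 's \<Rightarrow> nat) \<Rightarrow> 'c set \<Rightarrow> ('c \<Rightarrow> 'c \<Rightarrow> 's cox) \<Rightarrow> ('c \<Rightarrow> 'c) \<Rightarrow> bool" where
  "building_aut M Ch \<delta> \<theta> \<longleftrightarrow> bij_betw \<theta> Ch Ch
     \<and> (\<exists>\<sigma>. bij \<sigma> \<and> (\<forall>s t. M (\<sigma> s) (\<sigma> t) = M s t)
          \<and> (\<forall>C\<in>Ch. \<forall>D\<in>Ch. \<delta> (\<theta> C) (\<theta> D) = cox_map M \<sigma> (\<delta> C D)))"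

text \<open>A simplex of type J, identified with its residue: the set of chambers containing it,
  which is a residue of type S - J.\<close>
definition simplex_of_type ::
  "('s \<Rightarrow> 's \<Rightarrow> nat) \<Rightarrow> 'c set \<Rightarrow> ('c \<Rightarrow> 'c \<Rightarrow> 's cox) \<Rightarrow> 's set \<Rightarrow> 'c set \<Rightarrow> bool" where
  "simplex_of_type M Ch \<delta> J R \<longleftrightarrow>
     (\<exists>C\<in>Ch. R = {D\<in>Ch. \<delta> C D \<in> cox_par M (- J)})"

definition opposite ::
  "('s \<Rightarrow> 's \<Rightarrow> nat) \<Rightarrow> ('c \<Rightarrow> 'c \<Rightarrow> 's cox) \<Rightarrow> 'c set \<Rightarrow> 'c set \<Rightarrow> bool" where
  "opposite M \<delta> R1 R2 \<longleftrightarrow>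
     (\<forall>C\<in>R1. \<exists>D\<in>R2. \<delta> C D = cox_longest M UNIV)
     \<and> (\<forall>D\<in>R2. \<exists>C\<in>R1. \<delta> D C = cox_longest M UNIV)"

definition aut_type ::
  "('s \<Rightarrow> 's \<Rightarrow> nat) \<Rightarrow> 'c set \<Rightarrow> ('c \<Rightarrow> 'c \<Rightarrow> 's cox) \<Rightarrow> ('c \<Rightarrow> 'c) \<Rightarrow> 's set" where
  "aut_type M Ch \<delta> \<theta> = \<Union> {J. \<exists>R. simplex_of_type M Ch \<delta> J R \<and> opposite M \<delta> R (\<theta> ` R)}"

definition capped ::
  "('s \<Rightarrow> 's \<Rightarrow> nat) \<Rightarrow> 'c set \<Rightarrow> ('c \<Rightarrow> 'c \<Rightarrow> 's cox) \<Rightarrow> ('c \<Rightarrow> 'c) \<Rightarrow> bool" where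
  "capped M Ch \<delta> \<theta> \<longleftrightarrow>
     (\<exists>R. simplex_of_type M Ch \<delta> (aut_type M Ch \<delta> \<theta>) R \<and> opposite M \<delta> R (\<theta> ` R))"

definition disp :: "'c set \<Rightarrow> ('c \<Rightarrow> 'c \<Rightarrow> 's cox) \<Rightarrow> ('c \<Rightarrow> 'c) \<Rightarrow> nat" where
  "disp Ch \<delta> \<theta> = Max {cox_len (\<delta> C (\<theta> C)) | C. C \<in> Ch}"

end

theory Submission
  imports Defs
begin

text \<open>
  A chamber C of maximal displacement, with \<open>w = \<delta>(C, C\<^sup>\<theta>)\<close> and K the set of left ascents of w,
  satisfies \<open>s w = w \<sigma>(s)\<close> for all \<open>s \<in> K\<close>: otherwise thickness and folding give an s-neighbour
  of C with larger displacement.  The element \<open>w w\<^sub>0\<close> then has left descent set K and conjugates K to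
  simple generators, which forces \<open>w w\<^sub>0 = w\<^sub>K\<close>; and the K-residue of C is opposite its image, so
  \<open>S - K \<subseteq> Type(\<theta>)\<close>, that is \<open>S - J \<subseteq> K\<close>.  Conversely, a simplex of type J opposite its image
  contains, by the triangle inequality, a chamber of displacement at least
  \<open>\<ell>(w\<^sub>0) - \<ell>(w\<^bsub>S-J\<^esub>)\<close>.  Hence \<open>\<ell>(w\<^sub>K) \<le> \<ell>(w\<^bsub>S-J\<^esub>)\<close>, and uniqueness of
  longest elements gives \<open>w\<^sub>K = w\<^bsub>S-J\<^esub>\<close>.

  The exchange condition needs no root system here: thickness of the building yields folding,
  and folding yields exchange.
\<close>

section \<open>Words in a Coxeter group\<close>

locale coxeter_words =
  fixes M :: "'s::finite \<Rightarrow> 's \<Rightarrow> nat"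
  assumes cox_matrix: "coxeter_matrix M"
begin

abbreviation cl :: "'s list \<Rightarrow> 's cox" where "cl \<equiv> cox_class M"
abbreviation L :: "'s list \<Rightarrow> nat" where "L w \<equiv> cox_len (cl w)"

section \<open>Word classes as group elements, with reversal as inversion\<close>

lemma cl_eq: "cl u = cl v \<longleftrightarrow> cox_eq M u v"
  unfolding cox_class_def by (auto intro: cox_eq.intros(1-3))

lemma cl_ctxt: "cl u = cl v \<Longrightarrow> cl (x @ u @ y) = cl (x @ v @ y)"
  by (simp add: cl_eq cox_eq.ctxt)

lemma cl_append: "cl u = cl u' \<Longrightarrow> cl v = cl v' \<Longrightarrow> cl (u @ v) = cl (u' @ v')"
  using cl_ctxt[of u u' "[]" v] cl_ctxt[of v v' u' "[]"] by simp

lemma cl_Cons: "cl u = cl v \<Longrightarrow> cl (s # u) = cl (s # v)"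
  using cl_append[of "[s]" "[s]" u v] by simp

text \<open>The choice made by \<open>cox_rep\<close> is a member of the class because the class is
  nonempty; operations defined through it can then be computed on arbitrary words.\<close>

lemma cl_cox_rep: "cl (cox_rep (cl w)) = cl w"
proof -
  have "w \<in> cl w" by (simp add: cox_class_def cox_eq.refl)
  hence "cox_rep (cl w) \<in> cl w" unfolding cox_rep_def by (rule someI)
  hence "cox_eq M w (cox_rep (cl w))" by (simp add: cox_class_def)
  thus ?thesis using cl_eq by metis
qed

lemma mult_cl: "cox_mult M (cl u) (cl v) = cl (u @ v)"
  unfolding cox_mult_def by (rule cl_append) (rule cl_cox_rep)+

text \<open>The diagonal entry \<open>M s s = 1\<close> makes the Coxeter relation for the pair
  \<open>s\<close>, \<open>s\<close> say that generators are involutions.\<close>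

lemma cl_square: "cl (x @ [s, s] @ y) = cl (x @ y)"
proof -
  have "M s s = 1" using cox_matrix by (simp add: coxeter_matrix_def)
  hence "cox_eq M [s, s] []" using cox_eq.rel[of M s s] by (simp add: numeral_2_eq_2)
  thus ?thesis using cl_ctxt[of "[s, s]" "[]" x y] by (simp add: cl_eq)
qed

lemma cl_Cons_Cons: "cl (s # s # w) = cl w"
  using cl_square[of "[]" s w] by simp

lemma cl_rev_right: "cl (w @ rev w) = cl []"
proof (induction w rule: rev_induct)
  case (snoc s w)
  then show ?case using cl_square[of w s "rev w"] by simp
qed simp

lemma cl_rev_left: "cl (rev w @ w) = cl []"
  using cl_rev_right[of "rev w"] by simp

lemma cl_cancel_left: "cl (u @ v) = cl (u @ v') \<longleftrightarrow> cl v = cl v'"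
proof
  assume "cl (u @ v) = cl (u @ v')"
  hence "cl (rev u @ u @ v) = cl (rev u @ u @ v')" by (rule cl_append[OF HOL.refl])
  moreover have "cl (rev u @ u @ y) = cl y" for y
    using cl_append[OF cl_rev_left[of u], of y y] by simp
  ultimately show "cl v = cl v'" by metis
qed (rule cl_append[OF HOL.refl])

lemma cl_cancel_right: "cl (u @ v) = cl (u' @ v) \<longleftrightarrow> cl u = cl u'"
proof
  assume "cl (u @ v) = cl (u' @ v)"
  hence "cl ((u @ v) @ rev v) = cl ((u' @ v) @ rev v)" by (rule cl_append[OF _ HOL.refl])
  moreover have "cl ((y @ v) @ rev v) = cl y" for y
    using cl_append[of y y, OF _ cl_rev_right[of v]] by simp
  ultimately show "cl u = cl u'" by metis
qed (rule cl_append[OF _ HOL.refl])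

lemma cl_cancel_rev_left: "cl (rev u @ u @ y) = cl y"
  using cl_append[OF cl_rev_left[of u], of y y] by simp

lemma cl_cancel_rev_left': "cl (u @ rev u @ y) = cl y"
  using cl_cancel_rev_left[of "rev u" y] by simp

lemma cl_rev_append_eq: "cl (rev u @ v) = cl [] \<longleftrightarrow> cl u = cl v"
  using cl_cancel_left[of "rev u" v u] cl_rev_left[of u] by auto

lemma cl_rev:
  assumes "cl u = cl v" shows "cl (rev u) = cl (rev v)"
proof -
  have "cl (rev u @ v) = cl (rev v @ v)"
    using iffD2[OF cl_rev_append_eq assms] cl_rev_left[of v] by simp
  thus ?thesis by (simp add: cl_cancel_right)
qed

text \<open>Coxeter relators have even length, so the sign character is well defined on
  classes.\<close>

lemma cox_eq_parity: "cox_eq M u v \<Longrightarrow> even (length u) = even (length v)"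
proof (induction rule: cox_eq.induct)
  case (rel s t)
  have "length (alt_word s t n) = n" for n and s t :: 's
    by (induction n arbitrary: s t) auto
  then show ?case by simp
qed auto

section \<open>The length function\<close>

lemma reduced_word_exists: "\<exists>u. cl u = cl w \<and> length u = L w"
proof -
  have "\<exists>n. \<exists>u\<in>cl w. length u = n"
    by (auto simp: cox_class_def intro: cox_eq.refl)
  hence "\<exists>u\<in>cl w. length u = L w" unfolding cox_len_def by (rule LeastI_ex)
  then obtain u where "u \<in> cl w" "length u = L w" by blast
  moreover from this(1) have "cox_eq M w u" by (simp add: cox_class_def)
  hence "cl u = cl w" using cl_eq by metis
  ultimately show ?thesis by blast
qed

lemma L_le_length: "L w \<le> length w"
  unfolding cox_len_def by (rule Least_le) (auto simp: cox_class_def intro: cox_eq.refl)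

lemma L_le: "cl u = cl w \<Longrightarrow> L w \<le> length u"
  using L_le_length[of u] by simp

lemma L_append: "L (u @ v) \<le> L u + L v"
proof -
  obtain u' where u: "cl u' = cl u" "length u' = L u" using reduced_word_exists by blast
  obtain v' where v: "cl v' = cl v" "length v' = L v" using reduced_word_exists by blast
  show ?thesis using L_le[OF cl_append[OF u(1) v(1)]] u v by simp
qed

lemma L_rev: "L (rev w) = L w"
proof -
  have "L (rev w) \<le> L w" for w
  proof -
    obtain u where "cl u = cl w" "length u = L w" using reduced_word_exists by blast
    thus ?thesis using L_le[OF cl_rev, of u w] by simp
  qed
  from this[of w] this[of "rev w"] show ?thesis by simp
qed

lemma L_parity: "even (L w) = even (length w)"
proof -
  obtain u where "cl u = cl w" "length u = L w" using reduced_word_exists by blast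
  thus ?thesis using cox_eq_parity cl_eq by metis
qed

text \<open>A generator changes the length by at most one, and parity excludes no change.\<close>

lemma L_Cons: "L (s # w) = L w + 1 \<or> L w = L (s # w) + 1"
proof -
  have 1: "L (s # u) \<le> L u + 1" for u
    using L_append[of "[s]" u] L_le_length[of "[s]"] by simp
  have "L w = L (s # s # w)" by (simp add: cl_Cons_Cons)
  hence "L w \<le> L (s # w) + 1" using 1[of "s # w"] by simp
  moreover have "L (s # w) \<noteq> L w" using L_parity[of w] L_parity[of "s # w"] by auto
  ultimately show ?thesis using 1[of w] by linarith
qed

lemma L_snoc: "L (w @ [s]) = L w + 1 \<or> L w = L (w @ [s]) + 1"
  using L_Cons[of s "rev w"] L_rev[of w] L_rev[of "w @ [s]"] by simp

lemma L_Nil: "L [] = 0"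
  using L_le_length[of "[]"] by simp

lemma L_single: "L [s] = 1"
  using L_Cons[of s "[]"] L_Nil by simp

lemma L_eq_0: "L w = 0 \<Longrightarrow> cl w = cl []"
  using reduced_word_exists[of w] by auto

lemma L_Suc:
  assumes "L w = Suc n"
  obtains s u where "cl w = cl (s # u)" "L u = n"
proof -
  obtain v where v: "cl v = cl w" "length v = Suc n" using reduced_word_exists[of w] assms by auto
  then obtain s u where su: "v = s # u" "length u = n" by (cases v) auto
  have "L u = n" using L_Cons[of s u] L_le_length[of u] su v assms by auto
  thus ?thesis using that v su by metis
qed

lemma cl_Cons_neq: "cl (s # w) \<noteq> cl w"
  using L_Cons[of s w] by auto

lemma cl_in_coxW: "a \<in> coxW M \<Longrightarrow> \<exists>w. a = cl w"
  by (auto simp: coxW_def)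

lemma in_par: "cl w \<in> cox_par M K \<longleftrightarrow> (\<exists>u. set u \<subseteq> K \<and> cl w = cl u)"
  by (auto simp: cox_par_def)

end

locale coxeter_aut = coxeter_words M for M :: "'s::finite \<Rightarrow> 's \<Rightarrow> nat" +
  fixes \<sigma> :: "'s \<Rightarrow> 's"
  assumes bij: "bij \<sigma>" and M_aut: "M (\<sigma> s) (\<sigma> t) = M s t"
begin

text \<open>A diagram automorphism maps Coxeter relators to Coxeter relators.\<close>

lemma cl_map:
  assumes "cl u = cl v" shows "cl (map \<sigma> u) = cl (map \<sigma> v)"
proof -
  have alt: "map \<sigma> (alt_word s t n) = alt_word (\<sigma> s) (\<sigma> t) n" for s t n
    by (induction n arbitrary: s t) auto
  have "cox_eq M u v \<Longrightarrow> cox_eq M (map \<sigma> u) (map \<sigma> v)"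
  proof (induction rule: cox_eq.induct)
    case (rel s t)
    then show ?case using cox_eq.rel[of M "\<sigma> s" "\<sigma> t"] by (simp add: alt M_aut)
  qed (auto intro: cox_eq.intros)
  thus ?thesis using assms by (simp add: cl_eq)
qed

lemma cox_map_cl: "cox_map M \<sigma> (cl w) = cl (map \<sigma> w)"
  unfolding cox_map_def by (rule cl_map) (rule cl_cox_rep)

lemma inverse_aut: "coxeter_aut M (inv \<sigma>)"
proof
  show "bij (inv \<sigma>)" using bij by (rule bij_imp_bij_inv)
  show "M (inv \<sigma> s) (inv \<sigma> t) = M s t" for s t
    using M_aut[of "inv \<sigma> s" "inv \<sigma> t"] bij by (simp add: bij_is_surj surj_f_inv_f)
qed

lemma map_inv: "map (inv \<sigma>) (map \<sigma> w) = w"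
  using bij by (simp add: bij_is_inj)

lemma cl_map_iff: "cl (map \<sigma> u) = cl (map \<sigma> v) \<longleftrightarrow> cl u = cl v"
  using coxeter_aut.cl_map[OF inverse_aut, of "map \<sigma> u" "map \<sigma> v"] cl_map
  unfolding map_inv by blast

lemma L_map: "L (map \<sigma> w) = L w"
proof -
  have *: "L (map \<tau> w) \<le> L w" if "coxeter_aut M \<tau>" for \<tau> w
  proof -
    obtain u where "cl u = cl w" "length u = L w" using reduced_word_exists by blast
    thus ?thesis using L_le[OF coxeter_aut.cl_map[OF that], of u w] by simp
  qed
  have "coxeter_aut M \<sigma>" by unfold_locales
  from *[OF this, of w] *[OF inverse_aut, of "map \<sigma> w"] show ?thesis
    unfolding map_inv by simp
qed

text \<open>Serves to pull a chamber found near the image of C back to a chamber near C.\<close>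

lemma in_par_map:
  assumes "cl (map \<sigma> w) \<in> cox_par M (\<sigma> ` K)" shows "cl w \<in> cox_par M K"
proof -
  obtain u where u: "set u \<subseteq> \<sigma> ` K" "cl (map \<sigma> w) = cl u" using assms in_par by blast
  have "cl w = cl (map (inv \<sigma>) u)"
    using coxeter_aut.cl_map[OF inverse_aut u(2)] unfolding map_inv .
  moreover have "set (map (inv \<sigma>) u) \<subseteq> K"
    using u(1) bij by (auto simp: bij_is_inj)
  ultimately show ?thesis using in_par by blast
qed

end

section \<open>Thick buildings and the exchange condition\<close>

locale thick_coxeter_building = coxeter_words M for M :: "'s::finite \<Rightarrow> 's \<Rightarrow> nat" +
  fixes Ch :: "'c set" and \<delta> :: "'c \<Rightarrow> 'c \<Rightarrow> 's cox"
  assumes thick: "thick_building M Ch \<delta>"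
begin

section \<open>Calculus of Weyl distances along galleries\<close>

lemma building: "building M Ch \<delta>"
  using thick by (simp add: thick_building_def)

lemma delta_word: "C \<in> Ch \<Longrightarrow> D \<in> Ch \<Longrightarrow> \<exists>w. \<delta> C D = cl w"
proof -
  assume CD: "C \<in> Ch" "D \<in> Ch"
  have "\<forall>C\<in>Ch. \<forall>D\<in>Ch. \<delta> C D \<in> coxW M"
    using building unfolding building_def by (elim conjE)
  thus ?thesis using CD cl_in_coxW by blast
qed

lemma delta_one: "C \<in> Ch \<Longrightarrow> D \<in> Ch \<Longrightarrow> \<delta> C D = cl [] \<longleftrightarrow> C = D"
proof -
  assume CD: "C \<in> Ch" "D \<in> Ch"
  have "\<forall>C\<in>Ch. \<forall>D\<in>Ch. \<delta> C D = cox_one M \<longleftrightarrow> C = D"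
    using building unfolding building_def by (elim conjE)
  thus ?thesis using CD by (simp add: cox_one_def)
qed

lemma step:
  assumes "C \<in> Ch" "D \<in> Ch" "C' \<in> Ch" "\<delta> C' C = cl [s]" "\<delta> C D = cl w"
  shows "\<delta> C' D = cl (s # w) \<or> \<delta> C' D = cl w"
    and "L (s # w) = L w + 1 \<Longrightarrow> \<delta> C' D = cl (s # w)"
proof -
  have "\<forall>C\<in>Ch. \<forall>D\<in>Ch. \<forall>C'\<in>Ch. \<forall>s. \<delta> C' C = cox_gen M s \<longrightarrow>
          \<delta> C' D \<in> {cox_mult M (cox_gen M s) (\<delta> C D), \<delta> C D}
          \<and> (cox_len (cox_mult M (cox_gen M s) (\<delta> C D)) = cox_len (\<delta> C D) + 1
               \<longrightarrow> \<delta> C' D = cox_mult M (cox_gen M s) (\<delta> C D))"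
    using building unfolding building_def by (elim conjE)
  note this[rule_format, OF assms(1-3), of s]
  thus "\<delta> C' D = cl (s # w) \<or> \<delta> C' D = cl w"
    and "L (s # w) = L w + 1 \<Longrightarrow> \<delta> C' D = cl (s # w)"
    using assms(4,5) by (auto simp: cox_gen_def mult_cl)
qed

lemma extend:
  assumes "C \<in> Ch" "D \<in> Ch" "\<delta> C D = cl w"
  shows "\<exists>C'\<in>Ch. \<delta> C' C = cl [s] \<and> \<delta> C' D = cl (s # w)"
proof -
  have "\<exists>C'\<in>Ch. \<delta> C' C = cox_gen M s \<and> \<delta> C' D = cox_mult M (cox_gen M s) (\<delta> C D)"
  proof -
    have "\<forall>C\<in>Ch. \<forall>D\<in>Ch. \<forall>s. \<exists>C'\<in>Ch. \<delta> C' C = cox_gen M s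
        \<and> \<delta> C' D = cox_mult M (cox_gen M s) (\<delta> C D)"
      using building unfolding building_def by (elim conjE)
    thus ?thesis using assms(1,2) by blast
  qed
  thus ?thesis using assms(3) by (simp add: cox_gen_def mult_cl)
qed

text \<open>Apply \<open>step\<close> with target \<open>D\<close> itself: the distance 1 from
  \<open>D\<close> to \<open>D\<close> is s w or w, and w = 1 would force
  \<open>C = D\<close>.\<close>

lemma adjacent_sym:
  assumes "C \<in> Ch" "D \<in> Ch" "\<delta> D C = cl [s]"
  shows "\<delta> C D = cl [s]"
proof -
  obtain w where w: "\<delta> C D = cl w" using delta_word assms by blast
  have one: "\<delta> D D = cl []" using delta_one assms by blast
  have "cl (s # w) = cl [] \<or> cl w = cl []" using step(1)[OF assms(1,2,2,3) w] one by auto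
  thus ?thesis
  proof
    assume "cl (s # w) = cl []"
    hence "cl w = cl [s]" using cl_Cons[of "s # w" "[]" s] by (simp add: cl_Cons_Cons)
    thus ?thesis using w by simp
  next
    assume "cl w = cl []"
    hence "C = D" using delta_one assms w by simp
    hence "cl [s] = cl []" using one assms(3) by simp
    thus ?thesis using cl_Cons_neq by blast
  qed
qed

text \<open>Additivity of length forces the length-increasing case of \<open>step\<close> at each
  letter of \<open>u\<close>.\<close>

lemma delta_append:
  assumes "C \<in> Ch" "D \<in> Ch" "E \<in> Ch" "\<delta> C D = cl u" "\<delta> D E = cl v" "L (u @ v) = L u + L v"
  shows "\<delta> C E = cl (u @ v)"
  using assms
proof (induction "L u" arbitrary: C u)
  case 0
  hence "cl u = cl []" using L_eq_0 by simp
  moreover from this have "C = D" using 0 delta_one by simp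
  ultimately show ?case using 0 cl_append[of u "[]" v v] by simp
next
  case (Suc n)
  then obtain s u' where u: "cl u = cl (s # u')" "L u' = n" using L_Suc by metis
  \<comment> \<open>Extending by the first letter \<open>s\<close> of the distance cancels it, so
    \<open>C'\<close> is one step closer to \<open>D\<close>.\<close>
  obtain C' where C': "C' \<in> Ch" "\<delta> C' C = cl [s]" "\<delta> C' D = cl (s # s # u')"
    using extend[of C D "s # u'" s] Suc.prems u by auto
  have eq: "cl (u @ v) = cl (s # u' @ v)" using cl_append[OF u(1), of v v] by simp
  have len: "L (u' @ v) = L u' + L v"
    using L_append[of u' v] L_Cons[of s "u' @ v"] Suc.prems(6) Suc.hyps(2) u eq by auto
  have "\<delta> C' E = cl (u' @ v)"
    using Suc.hyps(1)[of u' C'] u C' Suc.prems len by (simp add: cl_Cons_Cons)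
  moreover have "L (s # u' @ v) = L (u' @ v) + 1"
    using len u Suc.hyps(2) Suc.prems(6) eq by simp
  ultimately have "\<delta> C E = cl (s # u' @ v)"
    using step(2)[of C' E C s "u' @ v"] adjacent_sym C' Suc.prems by blast
  then show ?case using eq by simp
qed

text \<open>Peel off the first letter and append it at the other end; \<open>delta_append\<close>
  applies because reversal preserves length.\<close>

lemma delta_sym:
  assumes "C \<in> Ch" "D \<in> Ch" "\<delta> C D = cl w"
  shows "\<delta> D C = cl (rev w)"
  using assms
proof (induction "L w" arbitrary: C w)
  case 0
  hence "cl w = cl []" using L_eq_0 by simp
  moreover from this have "C = D" using 0 delta_one by simp
  ultimately show ?case using 0 cl_rev[of w "[]"] by simp
next
  case (Suc n)
  then obtain s u where u: "cl w = cl (s # u)" "L u = n" using L_Suc by metis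
  obtain C' where C': "C' \<in> Ch" "\<delta> C' C = cl [s]" "\<delta> C' D = cl (s # s # u)"
    using extend[of C D "s # u" s] Suc.prems u by auto
  have "\<delta> D C' = cl (rev u)"
    using Suc.hyps(1)[of u C'] u C' Suc.prems by (simp add: cl_Cons_Cons)
  moreover have "L (rev u @ [s]) = L (rev u) + L [s]"
    using L_rev[of "s # u"] L_rev[of u] u Suc.hyps(2) L_single by simp
  ultimately have "\<delta> D C = cl (rev u @ [s])"
    using delta_append[of D C' C "rev u" "[s]"] C' Suc.prems by blast
  then show ?case using cl_rev[OF u(1)] by simp
qed

lemma step_right:
  assumes "C \<in> Ch" "D \<in> Ch" "D' \<in> Ch" "\<delta> D D' = cl [s]" "\<delta> C D = cl w"
  shows "\<delta> C D' = cl (w @ [s]) \<or> \<delta> C D' = cl w"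
proof -
  have "\<delta> D' D = cl [s]" using delta_sym[OF assms(2-4)] by simp
  hence "\<delta> D' C = cl (s # rev w) \<or> \<delta> D' C = cl (rev w)"
    using step(1)[of D C D' s "rev w"] delta_sym assms by blast
  thus ?thesis using delta_sym[of D' C "s # rev w"] delta_sym[of D' C "rev w"] assms by auto
qed

text \<open>Iterates \<open>extend\<close>. The word \<open>x\<close> may differ from
  \<open>z\<close>, since \<open>step\<close> can leave a distance unchanged, but its letters come
  from \<open>z\<close>, so the walk stays in one residue.\<close>

lemma walk:
  assumes "C \<in> Ch" "D \<in> Ch" "\<delta> C D = cl w"
  shows "\<exists>C'\<in>Ch. \<exists>x. set x \<subseteq> set z \<and> \<delta> C' C = cl x \<and> \<delta> C' D = cl (z @ w)"
proof (induction z)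
  case Nil
  have "\<delta> C C = cl []" using delta_one assms(1) by blast
  then show ?case using assms by (intro bexI[of _ C] exI[of _ "[]"]) simp_all
next
  case (Cons s z)
  then obtain C' x where C': "C' \<in> Ch" "set x \<subseteq> set z" "\<delta> C' C = cl x" "\<delta> C' D = cl (z @ w)"
    by blast
  then obtain C'' where C'': "C'' \<in> Ch" "\<delta> C'' C' = cl [s]" "\<delta> C'' D = cl (s # z @ w)"
    using extend[OF C'(1) assms(2) C'(4)] by blast
  have "\<delta> C'' C = cl (s # x) \<or> \<delta> C'' C = cl x"
    using step(1)[OF C'(1) assms(1) C''(1,2) C'(3)] .
  moreover have "set (s # x) \<subseteq> set (s # z)" "set x \<subseteq> set (s # z)" using C' by auto
  ultimately have "\<exists>y. set y \<subseteq> set (s # z) \<and> \<delta> C'' C = cl y" by blast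
  moreover have "\<delta> C'' D = cl ((s # z) @ w)" using C''(3) by simp
  ultimately show ?case using C''(1) by blast
qed

lemma walk_right:
  assumes "C \<in> Ch" "D \<in> Ch" "\<delta> C D = cl w"
  shows "\<exists>D'\<in>Ch. \<exists>x. set x \<subseteq> set z \<and> \<delta> D D' = cl x \<and> \<delta> C D' = cl (w @ z)"
proof -
  obtain D' x where D': "D' \<in> Ch" "set x \<subseteq> set (rev z)" "\<delta> D' D = cl x"
      "\<delta> D' C = cl (rev z @ rev w)"
    using walk[of D C "rev w" "rev z"] delta_sym[OF assms] assms by blast
  have "\<delta> D D' = cl (rev x)" "\<delta> C D' = cl (w @ z)"
    using delta_sym[OF D'(1) assms(2) D'(3)] delta_sym[OF D'(1) assms(1) D'(4)] by simp_all
  thus ?thesis using D'(1,2) by (intro bexI[of _ D'] exI[of _ "rev x"]) simp_all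
qed

lemma triangle:
  assumes "C \<in> Ch" "D \<in> Ch" "E \<in> Ch" "\<delta> C D = cl u" "\<delta> D E = cl v"
  shows "cox_len (\<delta> C E) \<le> L u + L v"
  using assms
proof (induction "L u" arbitrary: C u)
  case 0
  hence "\<delta> C D = cl []" using L_eq_0[of u] by simp
  hence "C = D" using delta_one[OF 0(2,3)] by simp
  then show ?case using 0 by simp
next
  case (Suc n)
  obtain s u' where u: "cl u = cl (s # u')" "L u' = n" using L_Suc[OF Suc.hyps(2)[symmetric]] .
  have "\<delta> C D = cl (s # u')" using Suc.prems(4) u(1) by simp
  then obtain C' where C': "C' \<in> Ch" "\<delta> C' C = cl [s]" "\<delta> C' D = cl (s # s # u')"
    using extend[OF Suc.prems(1,2)] by blast
  have "\<delta> C' D = cl u'" by (simp only: C'(3) cl_Cons_Cons)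
  hence le: "cox_len (\<delta> C' E) \<le> L u' + L v"
    using Suc.hyps(1)[OF u(2)[symmetric] C'(1) Suc.prems(2,3) _ Suc.prems(5)] by simp
  obtain y where y: "\<delta> C' E = cl y" using delta_word[OF C'(1) Suc.prems(3)] by blast
  have "\<delta> C E = cl (s # y) \<or> \<delta> C E = cl y"
    using step(1)[OF C'(1) Suc.prems(3,1) adjacent_sym[OF Suc.prems(1) C'(1,2)] y] .
  hence "cox_len (\<delta> C E) \<le> L y + 1" using L_Cons[of s y] by (elim disjE) simp_all
  moreover have "L y \<le> n + L v" using le y u(2) by simp
  ultimately show ?case using Suc.hyps(2) by linarith
qed

text \<open>Only one chamber of the s-panel of \<open>C\<close> is nearer to \<open>D\<close>;
  thickness provides another chamber besides \<open>C\<close> that keeps distance w.\<close>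

lemma stay:
  assumes "C \<in> Ch" "D \<in> Ch" "\<delta> C D = cl w" "L (s # w) < L w"
  shows "\<exists>C'\<in>Ch. \<delta> C' C = cl [s] \<and> \<delta> C' D = cl w"
proof -
  have "\<forall>C\<in>Ch. \<forall>s. \<exists>D1\<in>Ch. \<exists>D2\<in>Ch. D1 \<noteq> D2 \<and> \<delta> C D1 = cl [s] \<and> \<delta> C D2 = cl [s]"
    using thick unfolding thick_building_def cox_gen_def by (elim conjE)
  then obtain D1 D2 where
    D: "D1 \<in> Ch" "D2 \<in> Ch" "D1 \<noteq> D2" "\<delta> C D1 = cl [s]" "\<delta> C D2 = cl [s]"
    using assms(1) by blast
  have D': "\<delta> D1 C = cl [s]" "\<delta> D2 C = cl [s]"
    using adjacent_sym[OF D(1) assms(1) D(4)] adjacent_sym[OF D(2) assms(1) D(5)] .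
  show ?thesis
  proof (rule ccontr)
    assume no: "\<not> ?thesis"
    have 1: "\<delta> D1 D = cl (s # w)"
      using step(1)[OF assms(1,2) D(1) D'(1) assms(3)] no D(1) D'(1) by blast
    have 2: "\<delta> D2 D = cl (s # w)"
      using step(1)[OF assms(1,2) D(2) D'(2) assms(3)] no D(2) D'(2) by blast
    \<comment> \<open>Distinct chambers of one s-panel are s-adjacent. If both were at the shorter
      distance s w, the length-increasing case of \<open>step\<close> would put one of them at
      distance w.\<close>
    have "\<delta> D1 D2 = cl [s, s] \<or> \<delta> D1 D2 = cl [s]"
      using step(1)[OF assms(1) D(2,1) D'(1) D(5)] .
    moreover have "\<delta> D1 D2 \<noteq> cl []" using D(3) delta_one[OF D(1,2)] by simp
    ultimately have 3: "\<delta> D1 D2 = cl [s]" by (simp add: cl_Cons_Cons)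
    have "L (s # s # w) = L (s # w) + 1"
      using L_Cons[of s w] assms(4) by (simp add: cl_Cons_Cons)
    hence "\<delta> D1 D = cl (s # s # w)"
      using step(2)[OF D(2) assms(2) D(1) 3 2] by simp
    thus False using 1 cl_Cons_neq[of s "s # w"] by simp
  qed
qed

lemma stay_right:
  assumes "C \<in> Ch" "D \<in> Ch" "\<delta> C D = cl w" "L (w @ [s]) < L w"
  shows "\<exists>D'\<in>Ch. \<delta> D D' = cl [s] \<and> \<delta> C D' = cl w"
proof -
  have "L (s # rev w) < L (rev w)" using assms(4) L_rev[of w] L_rev[of "w @ [s]"] by simp
  then obtain D' where D': "D' \<in> Ch" "\<delta> D' D = cl [s]" "\<delta> D' C = cl (rev w)"
    using stay[OF assms(2,1) delta_sym[OF assms(1-3)]] by blast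
  have "\<delta> D D' = cl [s]" using adjacent_sym[OF assms(2) D'(1,2)] .
  moreover have "\<delta> C D' = cl w" using delta_sym[OF D'(1) assms(1) D'(3)] by simp
  ultimately show ?thesis using D'(1) by blast
qed

text \<open>Walk away from a chamber along \<open>w\<close>. Statements about words can thereby be
  proved with chambers.\<close>

lemma realise: "\<exists>C\<in>Ch. \<exists>D\<in>Ch. \<delta> C D = cl w"
proof -
  have "Ch \<noteq> {}" using building unfolding building_def by (elim conjE)
  then obtain C where C: "C \<in> Ch" by blast
  have "\<delta> C C = cl []" using delta_one[OF C C] by simp
  from walk[OF C C this, of w] show ?thesis using C by auto
qed

text \<open>Thickness lets C move inside its s-panel without changing its distance to the t-neighbour
  of D; computing that distance via D leaves only \<open>s w = w t\<close>.\<close>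

lemma folding:
  assumes "L (s # w) = L w + 1" "L (w @ [t]) = L w + 1" "L (s # w @ [t]) \<noteq> L w + 2"
  shows "cl (s # w) = cl (w @ [t])"
proof -
  obtain C D where C: "C \<in> Ch" "D \<in> Ch" "\<delta> C D = cl w" using realise by blast
  obtain D' where D': "D' \<in> Ch" "\<delta> D' D = cl [t]" "\<delta> D' C = cl (t # rev w)"
    using extend[OF C(2,1) delta_sym[OF C]] by blast
  have CD': "\<delta> C D' = cl (w @ [t])" using delta_sym[OF D'(1) C(1) D'(3)] by simp
  \<comment> \<open>Lengths change by one, so the excluded value leaves only a drop; this is the
    descent that \<open>stay\<close> requires.\<close>
  have "L (s # w @ [t]) < L (w @ [t])" using L_Cons[of s "w @ [t]"] assms by auto
  then obtain C' where C': "C' \<in> Ch" "\<delta> C' C = cl [s]" "\<delta> C' D' = cl (w @ [t])"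
    using stay[OF C(1) D'(1) CD'] by blast
  have "\<delta> C' D = cl (s # w)" by (rule step(2)[OF C(1,2) C'(1,2) C(3) assms(1)])
  moreover have "\<delta> D D' = cl [t]" by (rule adjacent_sym[OF C(2) D'(1,2)])
  ultimately have "\<delta> C' D' = cl ((s # w) @ [t]) \<or> \<delta> C' D' = cl (s # w)"
    using step_right[OF C'(1) C(2) D'(1)] by blast
  \<comment> \<open>The alternative s w t = w t is impossible, since \<open>s\<close> changes the
    length.\<close>
  thus ?thesis using cl_Cons_neq[of s "w @ [t]"] C'(3) by auto
qed

text \<open>Move letters of \<open>b\<close> into the prefix \<open>a\<close> while \<open>s\<close>
  still lengthens the prefix; at the first letter where this fails, \<open>folding\<close> deletes
  that letter.\<close>

lemma exchange:
  assumes "L (s # a) = L a + 1" "L (a @ b) = L a + length b" "L (s # a @ b) < L (a @ b)"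
  shows "\<exists>b'. set b' \<subseteq> set b \<and> length b' < length b \<and> cl (s # a @ b) = cl (a @ b')"
  using assms
proof (induction b arbitrary: a)
  case Nil
  then show ?case by simp
next
  case (Cons t b)
  have le: "L (a @ t # b) \<le> L (a @ [t]) + length b"
    using L_append[of "a @ [t]" b] L_le_length[of b] by simp
  hence at: "L (a @ [t]) = L a + 1" using L_snoc[of a t] Cons.prems(2) by auto
  show ?case
  proof (cases "L (s # a @ [t]) = L (a @ [t]) + 1")
    case True
    have "L ((a @ [t]) @ b) = L (a @ [t]) + length b" using at Cons.prems(2) by simp
    moreover have "L (s # (a @ [t]) @ b) < L ((a @ [t]) @ b)" using Cons.prems(3) by simp
    ultimately obtain b' where
      b': "set b' \<subseteq> set b" "length b' < length b" "cl (s # (a @ [t]) @ b) = cl ((a @ [t]) @ b')"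
      using Cons.IH[OF True] by blast
    have "cl (s # a @ t # b) = cl (a @ t # b')" using b'(3) by simp
    moreover have "set (t # b') \<subseteq> set (t # b)" "length (t # b') < length (t # b)"
      using b'(1,2) by auto
    ultimately show ?thesis by blast
  next
    case False
    \<comment> \<open>Passing \<open>s\<close> through \<open>a\<close> turns it into
      \<open>t\<close>, which cancels against the first letter of \<open>t # b\<close>.\<close>
    hence "cl (s # a) = cl (a @ [t])" using folding[of s a t] at Cons.prems by auto
    hence "cl (s # a @ t # b) = cl (a @ [t, t] @ b)"
      using cl_append[OF _ HOL.refl, of "s # a" "a @ [t]" "t # b"] by simp
    hence "cl (s # a @ t # b) = cl (a @ b)" by (simp only: cl_square)
    moreover have "set b \<subseteq> set (t # b)" "length b < length (t # b)" by auto
    ultimately show ?thesis by blast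
  qed
qed

text \<open>Prepend letters one at a time; whenever the length drops, \<open>exchange\<close> with
  empty prefix supplies a shorter word in the same letters. Reduced words can thus be chosen inside
  a parabolic subgroup.\<close>

lemma reduced_subword: "\<exists>u'. set u' \<subseteq> set u \<and> cl u' = cl u \<and> length u' = L u"
proof (induction u)
  case Nil
  show ?case by (simp add: L_Nil)
next
  case (Cons s u)
  then obtain v where v: "set v \<subseteq> set u" "cl v = cl u" "length v = L u" by blast
  have eq: "cl (s # v) = cl (s # u)" by (rule cl_Cons[OF v(2)])
  show ?case
  proof (cases "L (s # u) = L u + 1")
    case True
    have "set (s # v) \<subseteq> set (s # u)" "length (s # v) = L (s # u)" using v True by auto
    then show ?thesis using eq by blast
  next
    case False
    hence lt: "L u = L (s # u) + 1" using L_Cons[of s u] by blast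
    have "L [s] = L [] + 1" "L ([] @ v) = L [] + length v" "L (s # [] @ v) < L ([] @ v)"
      using L_Nil L_single v(2,3) eq lt by simp_all
    from exchange[OF this] obtain b where
      b: "set b \<subseteq> set v" "length b < length v" "cl (s # v) = cl b" by auto
    have "cl b = cl (s # u)" using b(3) eq by simp
    moreover from this have "length b = L (s # u)"
      using L_le[of b "s # u"] b(2) v(3) lt by linarith
    moreover have "set b \<subseteq> set (s # u)" using b(1) v(1) by auto
    ultimately show ?thesis by blast
  qed
qed

text \<open>Elements of the subgroup generated by \<open>K\<close> are reduced prefixes of
  \<open>x\<close>: each generator prepended to a reduced \<open>y\<close> takes a letter away from
  the remaining factor, by \<open>exchange\<close>.\<close>

lemma descent_decomposition:
  assumes desc: "\<And>s. s \<in> K \<Longrightarrow> L (s # x) < L x" and "set y \<subseteq> K"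
  shows "L x = L y + L (rev y @ x)"
proof -
  have red: "L x = length y + L (rev y @ x)" if "set y \<subseteq> K" "L y = length y" for y
    using that
  proof (induction y)
    case Nil
    show ?case by simp
  next
    case (Cons s y)
    have Ly: "L y = length y" "L (s # y) = L y + 1"
      using L_Cons[of s y] L_le_length[of y] Cons.prems by auto
    have IH: "L x = length y + L (rev y @ x)" using Cons.IH Cons.prems Ly by auto
    \<comment> \<open>\<open>z\<close> is a reduced remainder, x = y z. As \<open>s\<close>
      lengthens \<open>y\<close> but shortens \<open>x\<close>, the loss must occur in
      \<open>z\<close>.\<close>
    obtain z where z: "cl z = cl (rev y @ x)" "length z = L (rev y @ x)"
      using reduced_word_exists by blast
    have x: "cl (y @ z) = cl x"
      using cl_append[OF HOL.refl z(1), of y] cl_cancel_rev_left'[of y x] by simp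
    have sx: "cl (s # y @ z) = cl (s # x)" by (rule cl_Cons[OF x])
    have "L (y @ z) = L y + length z" using x IH z(2) Ly(1) by simp
    moreover have "L (s # y @ z) < L (y @ z)" using x sx desc[of s] Cons.prems(1) by simp
    ultimately obtain b where b: "length b < length z" "cl (s # y @ z) = cl (y @ b)"
      using exchange[OF Ly(2)] by blast
    have "cl (rev (s # y) @ x) = cl (rev y @ s # x)" by simp
    also have "\<dots> = cl (rev y @ y @ b)" using b(2) sx by (simp add: cl_cancel_left)
    also have "\<dots> = cl b" by (rule cl_cancel_rev_left)
    finally have "L (rev (s # y) @ x) < L (rev y @ x)"
      using L_le_length[of b] b(1) z(2) by simp
    moreover have "L (rev y @ x) \<le> L (rev (s # y) @ x) + 1"
    proof -
      have "cl (rev y @ x) = cl (rev y @ [s, s] @ x)" by (rule cl_square[symmetric])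
      hence "L x \<le> L (s # y) + L (rev (s # y) @ x)"
        using L_append[of "s # y" "rev (s # y) @ x"] cl_cancel_rev_left'[of "s # y" x] by simp
      thus ?thesis using Ly IH by simp
    qed
    ultimately show ?case using IH by simp
  qed
  \<comment> \<open>An arbitrary \<open>y\<close> reduces to the case above by a reduced word in the
    same letters.\<close>
  obtain u where u: "set u \<subseteq> set y" "cl u = cl y" "length u = L y"
    using reduced_subword by blast
  have "cl (rev u @ x) = cl (rev y @ x)" by (rule cl_append[OF cl_rev[OF u(2)] HOL.refl])
  moreover have "set u \<subseteq> K" "L u = length u" using u assms(2) by auto
  ultimately show ?thesis using red[of u] u(3) by simp
qed

end

section \<open>Longest elements\<close>

locale spherical_thick_building = thick_coxeter_building M Ch \<delta>
  for M :: "'s::finite \<Rightarrow> 's \<Rightarrow> nat" and Ch :: "'c set" and \<delta> :: "'c \<Rightarrow> 'c \<Rightarrow> 's cox" +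
  assumes sph: "spherical M"
begin

lemma maximal_word_exists: "\<exists>u. set u \<subseteq> K \<and> (\<forall>v. set v \<subseteq> K \<longrightarrow> L v \<le> L u)"
proof -
  let ?A = "{L u | u. set u \<subseteq> K}"
  have "?A \<subseteq> cox_len ` coxW M" by (auto simp: coxW_def)
  hence fin: "finite ?A" using sph finite_subset unfolding spherical_def by blast
  have "L [] \<in> ?A" by (intro CollectI exI[of _ "[]"]) simp
  hence "Max ?A \<in> ?A" using Max_in[OF fin] by blast
  then obtain u where u: "set u \<subseteq> K" "Max ?A = L u" by blast
  have "L v \<le> L u" if "set v \<subseteq> K" for v
    using Max_ge[OF fin, of "L v"] that u(2) by auto
  thus ?thesis using u(1) by blast
qed

text \<open>Maximality makes every generator in \<open>K\<close> a left descent of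
  \<open>u\<close>.\<close>

lemma maximal_word_decomposition:
  assumes "set u \<subseteq> K" "\<And>v. set v \<subseteq> K \<Longrightarrow> L v \<le> L u" "set y \<subseteq> K"
  shows "L u = L y + L (rev y @ u)"
proof (rule descent_decomposition[OF _ assms(3)])
  fix s assume "s \<in> K"
  hence "L (s # u) \<le> L u" using assms(1,2) by simp
  thus "L (s # u) < L u" using L_Cons[of s u] by linarith
qed

text \<open>The remainder in the decomposition has length zero.\<close>

lemma maximal_word_unique:
  assumes "set u \<subseteq> K" "\<And>v. set v \<subseteq> K \<Longrightarrow> L v \<le> L u" "set y \<subseteq> K" "L u \<le> L y"
  shows "cl y = cl u"
proof -
  have "L (rev y @ u) = 0" using maximal_word_decomposition[OF assms(1-3)] assms(4) by linarith
  thus ?thesis using L_eq_0 cl_rev_append_eq by blast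
qed

text \<open>A representative word for \<open>cox_longest\<close>, which can be concatenated with
  other words. It need not be reduced; only its class matters.\<close>

definition longest_word :: "'s set \<Rightarrow> 's list" where
  "longest_word K = (SOME u. set u \<subseteq> K \<and> (\<forall>v. set v \<subseteq> K \<longrightarrow> L v \<le> L u))"

lemma longest_word_subset: "set (longest_word K) \<subseteq> K"
  and longest_word_max: "set v \<subseteq> K \<Longrightarrow> L v \<le> L (longest_word K)"
  using someI_ex[OF maximal_word_exists[of K]] unfolding longest_word_def by blast+

lemma cl_longest_word: "cl (longest_word K) = cox_longest M K"
  unfolding cox_longest_def
proof (rule the_equality[symmetric])
  show "cl (longest_word K) \<in> cox_par M K \<and> (\<forall>v\<in>cox_par M K. cox_len v \<le> L (longest_word K))"
    using longest_word_subset longest_word_max by (auto simp: cox_par_def)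
next
  fix a assume a: "a \<in> cox_par M K \<and> (\<forall>v\<in>cox_par M K. cox_len v \<le> cox_len a)"
  then obtain u where u: "set u \<subseteq> K" "a = cl u" by (auto simp: cox_par_def)
  have "cl (longest_word K) \<in> cox_par M K" using longest_word_subset by (auto simp: cox_par_def)
  hence "L (longest_word K) \<le> L u" using a u(2) by blast
  thus "a = cl (longest_word K)" using maximal_word_unique[OF longest_word_subset longest_word_max u(1)] u(2) by simp
qed

text \<open>The decomposition for the inverse of \<open>x\<close>: multiplying by the longest
  element complements lengths. The sum avoids truncated subtraction.\<close>

lemma L_append_longest_word:
  assumes "set x \<subseteq> K" shows "L (x @ longest_word K) + L x = L (longest_word K)"
  using maximal_word_decomposition[OF longest_word_subset longest_word_max, of K "rev x"] assms L_rev[of x] by simp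

lemma cl_longest_word_square: "cl (longest_word K @ longest_word K) = cl []"
  using L_append_longest_word[OF longest_word_subset] L_eq_0 by simp

lemma cl_longest_word_cancel: "cl (longest_word K @ longest_word K @ y) = cl y"
  using cl_append[OF cl_longest_word_square HOL.refl, of K y] by simp

lemma cl_rev_longest_word: "cl (rev (longest_word K)) = cl (longest_word K)"
  using cl_rev_append_eq[of "longest_word K" "rev (longest_word K)"] cl_rev[OF cl_longest_word_square[of K]] by simp

section \<open>The longest element of the whole group\<close>

abbreviation w0 :: "'s list" where "w0 \<equiv> longest_word UNIV"

lemma L_append_w0: "L (x @ w0) + L x = L w0"
  by (rule L_append_longest_word) simp

lemma L_w0_append: "L (w0 @ x) + L x = L w0"
proof -
  have "cl (rev (w0 @ x)) = cl (rev x @ w0)"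
    using cl_append[OF HOL.refl cl_rev_longest_word, of "rev x" UNIV] by simp
  hence "L (w0 @ x) = L (rev x @ w0)" using L_rev[of "w0 @ x"] by simp
  thus ?thesis using L_append_w0[of "rev x"] L_rev[of x] by simp
qed

text \<open>Complementing the length on both sides shows that w0 s w0 has length one, so it is a
  generator.\<close>

lemma w0_conj: "\<exists>t. cl (s # w0) = cl (w0 @ [t])"
proof -
  have "L ((w0 @ [s]) @ w0) = 1"
    using L_append_w0[of "w0 @ [s]"] L_w0_append[of "[s]"] L_single[of s] by linarith
  hence 1: "L (w0 @ [s] @ w0) = Suc 0" by simp
  obtain t u where t: "cl (w0 @ [s] @ w0) = cl (t # u)" "L u = 0" using L_Suc[OF 1] .
  have "cl (w0 @ [s] @ w0) = cl [t]" using t cl_Cons[OF L_eq_0[OF t(2)]] by simp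
  hence "cl (w0 @ w0 @ [s] @ w0) = cl (w0 @ [t])" by (rule cl_append[OF HOL.refl])
  thus ?thesis using cl_longest_word_cancel[of UNIV "[s] @ w0"] by auto
qed

text \<open>Put v = w w0 and v = k y with k longest on \<open>K\<close>. A left descent t of a
  nontrivial y is forced into \<open>K\<close> because v conjugates \<open>K\<close> to generators;
  splitting k t off v then contradicts the maximality of k.\<close>

lemma ascents_characterise:
  assumes asc: "\<And>s. s \<in> K \<longleftrightarrow> L w < L (s # w)"
    and conj: "\<And>s. s \<in> K \<Longrightarrow> \<exists>t. cl (s # w) = cl (w @ [t])"
  shows "cl w = cl (longest_word K @ w0)"
proof -
  define v where "v = w @ w0"
  \<comment> \<open>Right multiplication by w0 complements lengths, turning ascents of
    \<open>w\<close> into descents of \<open>v\<close>.\<close>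
  have K: "s \<in> K \<longleftrightarrow> L (s # v) < L v" for s
    using asc[of s] L_append_w0[of w] L_append_w0[of "s # w"] L_Cons[of s w] unfolding v_def by auto
  have vconj: "\<exists>t. cl (s # v) = cl (v @ [t])" if s: "s \<in> K" for s
  proof -
    obtain t t' where t: "cl (s # w) = cl (w @ [t])" "cl (t # w0) = cl (w0 @ [t'])"
      using conj[OF s] w0_conj by blast
    have "cl (s # v) = cl (w @ t # w0)" unfolding v_def
      using cl_append[OF t(1) HOL.refl, of w0] by simp
    also have "\<dots> = cl (v @ [t'])" unfolding v_def
      using cl_append[OF HOL.refl t(2), of w] by simp
    finally show ?thesis by blast
  qed
  have push: "\<exists>z. length z = length u \<and> cl (u @ v) = cl (v @ z)" if "set u \<subseteq> K" for u
    using that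
  proof (induction u)
    case (Cons s u)
    then obtain z where z: "length z = length u" "cl (u @ v) = cl (v @ z)" by auto
    obtain t where t: "cl (s # v) = cl (v @ [t])" using vconj[of s] Cons.prems by auto
    have "cl (s # u @ v) = cl (s # v @ z)" by (rule cl_Cons[OF z(2)])
    also have "\<dots> = cl (v @ t # z)" using cl_append[OF t HOL.refl, of z] by simp
    finally show ?case using z(1) by (intro exI[of _ "t # z"]) simp
  qed simp
  define k where "k = longest_word K"
  define y where "y = rev k @ v"
  have k: "set k \<subseteq> K" unfolding k_def by (rule longest_word_subset)
  have Lv: "L v = L k + L y" unfolding y_def
    by (rule descent_decomposition[OF iffD1[OF K] k])
  have "L y = 0"
  proof (rule ccontr)
    assume "L y \<noteq> 0"
    then obtain n where "L y = Suc n" using not0_implies_Suc by blast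
    then obtain t y' where y': "cl y = cl (t # y')" "L y' = n" using L_Suc by blast
    have "cl (t # y) = cl (t # t # y')" by (rule cl_Cons[OF y'(1)])
    hence ty: "L (t # y) < L y" using \<open>L y = Suc n\<close> y'(2) by (simp add: cl_Cons_Cons)
    \<comment> \<open>A reduced word for the inverse of \<open>k\<close> gives y = v z with exactly
      L k letters in z. Read as v = y z^-1, this turns the descent t of \<open>y\<close> into a
      descent of \<open>v\<close>.\<close>
    obtain k' where k': "set k' \<subseteq> set (rev k)" "cl k' = cl (rev k)" "length k' = L (rev k)"
      using reduced_subword by blast
    have "set k' \<subseteq> K" using k' k by auto
    then obtain z where z: "length z = length k'" "cl (k' @ v) = cl (v @ z)" using push by blast
    have "cl y = cl (v @ z)" unfolding y_def using cl_append[OF k'(2) HOL.refl, of v] z(2) by simp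
    hence "cl (y @ rev z) = cl ((v @ z) @ rev z)" by (rule cl_append[OF _ HOL.refl])
    hence "cl v = cl (y @ rev z)"
      using cl_append[OF HOL.refl cl_rev_right[of z], of v] by simp
    hence "L (t # v) = L ((t # y) @ rev z)" using cl_Cons[of v "y @ rev z" t] by simp
    also have "\<dots> \<le> L (t # y) + L (rev z)" by (rule L_append)
    also have "\<dots> < L y + L k"
      using ty L_le_length[of "rev z"] z(1) k'(3) L_rev[of k] by simp
    finally have "t \<in> K" using K Lv by simp
    \<comment> \<open>The element k t also splits off \<open>v\<close>, with remainder t y, but it
      is no longer than k.\<close>
    hence tk: "set (k @ [t]) \<subseteq> K" using k by simp
    have "L v = L (k @ [t]) + L (rev (k @ [t]) @ v)"
      by (rule descent_decomposition[OF iffD1[OF K] tk])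
    also have "\<dots> \<le> L k + L (t # y)" unfolding y_def
      using longest_word_max[OF tk] k_def by simp
    finally show False using ty Lv by simp
  qed
  hence "cl k = cl v" using L_eq_0 cl_rev_append_eq unfolding y_def by blast
  hence "cl (k @ w0) = cl (w @ w0 @ w0)"
    using cl_append[OF _ HOL.refl, of k v w0] unfolding v_def by simp
  also have "\<dots> = cl w" using cl_append[OF HOL.refl cl_longest_word_square, of w UNIV] by simp
  finally show ?thesis unfolding k_def by simp
qed

text \<open>Two complementations, first by the longest element on \<open>K\<close> and then by w0,
  cancel. This yields the additive lengths needed inside the K-residue.\<close>

lemma L_append_longest_word_w0:
  assumes "set x \<subseteq> K" "cl w = cl (longest_word K @ w0)"
  shows "L (x @ w) = L x + L w"
proof -
  have "cl (x @ w) = cl ((x @ longest_word K) @ w0)" using cl_append[OF HOL.refl assms(2), of x] by simp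
  thus ?thesis
    using L_append_w0[of "x @ longest_word K"] L_append_w0[of "longest_word K"] L_append_longest_word[OF assms(1)] assms(2)
    by simp
qed

end

section \<open>Displacement of automorphisms\<close>

locale spherical_building_aut =
  spherical_thick_building M Ch \<delta> + coxeter_aut M \<sigma>
  for M :: "'s::finite \<Rightarrow> 's \<Rightarrow> nat" and Ch :: "'c set" and \<delta> :: "'c \<Rightarrow> 'c \<Rightarrow> 's cox"
    and \<sigma> :: "'s \<Rightarrow> 's" +
  fixes \<theta> :: "'c \<Rightarrow> 'c"
  assumes theta_bij: "bij_betw \<theta> Ch Ch"
    and delta_theta: "C \<in> Ch \<Longrightarrow> D \<in> Ch \<Longrightarrow> \<delta> (\<theta> C) (\<theta> D) = cox_map M \<sigma> (\<delta> C D)"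
begin

lemma theta_in: "C \<in> Ch \<Longrightarrow> \<theta> C \<in> Ch"
  using theta_bij bij_betwE by blast

lemma theta_surj: "D \<in> Ch \<Longrightarrow> \<exists>C\<in>Ch. D = \<theta> C"
  using theta_bij by (auto simp: bij_betw_def)

lemma delta_theta_word: "C \<in> Ch \<Longrightarrow> D \<in> Ch \<Longrightarrow> \<delta> C D = cl x \<Longrightarrow> \<delta> (\<theta> C) (\<theta> D) = cl (map \<sigma> x)"
  by (simp add: delta_theta cox_map_cl)

text \<open>If \<sigma>(s) shortens w on the right, or if s w \<sigma>(s) is longer by two, some
  s-neighbour of \<open>C\<close> has larger displacement; the remaining case is
  \<open>folding\<close>.\<close>

lemma max_displacement_conj:
  assumes C: "C \<in> Ch" "\<delta> C (\<theta> C) = cl w"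
    and max: "\<And>D. D \<in> Ch \<Longrightarrow> cox_len (\<delta> D (\<theta> D)) \<le> L w"
    and s: "L w < L (s # w)"
  shows "cl (s # w) = cl (w @ [\<sigma> s])"
proof -
  have sw: "L (s # w) = L w + 1" using s L_Cons[of s w] by linarith
  have no_descent: "\<not> L (w @ [\<sigma> s]) < L w"
  proof
    assume "L (w @ [\<sigma> s]) < L w"
    \<comment> \<open>The image is moved first: \<open>E\<close> turns out to be the image of an
      s-neighbour \<open>D\<close> of \<open>C\<close>, and \<open>D\<close> reaches it at distance
      s w.\<close>
    then obtain E where E: "E \<in> Ch" "\<delta> (\<theta> C) E = cl [\<sigma> s]" "\<delta> C E = cl w"
      using stay_right[OF C(1) theta_in[OF C(1)] C(2)] by blast
    obtain D where D: "D \<in> Ch" "E = \<theta> D" using theta_surj[OF E(1)] by blast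
    obtain x where x: "\<delta> C D = cl x" using delta_word[OF C(1) D(1)] by blast
    have "cl (map \<sigma> x) = cl (map \<sigma> [s])"
      using delta_theta_word[OF C(1) D(1) x] E(2) D(2) by simp
    hence "\<delta> C D = cl [s]" using x unfolding cl_map_iff by (simp only:)
    hence "\<delta> D C = cl [s]" by (rule adjacent_sym[OF D(1) C(1)])
    hence "\<delta> D (\<theta> D) = cl (s # w)"
      using step(2)[OF C(1) E(1) D(1) _ E(3) sw] D(2) by simp
    thus False using max[OF D(1)] sw by simp
  qed
  hence ws: "L (w @ [\<sigma> s]) = L w + 1" using L_snoc[of w "\<sigma> s"] by linarith
  have "L (s # w @ [\<sigma> s]) \<noteq> L w + 2"
  proof
    assume long: "L (s # w @ [\<sigma> s]) = L w + 2"
    obtain D where D: "D \<in> Ch" "\<delta> D C = cl [s]" using extend[OF C(1) theta_in[OF C(1)] C(2)] by blast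
    have CD: "\<delta> C D = cl [s]" by (rule adjacent_sym[OF C(1) D])
    have t: "\<delta> (\<theta> C) (\<theta> D) = cl [\<sigma> s]" using delta_theta_word[OF C(1) D(1) CD] by simp
    have "\<delta> C (\<theta> D) = cl (w @ [\<sigma> s])"
      using delta_append[OF C(1) theta_in[OF C(1)] theta_in[OF D(1)] C(2) t] ws L_single by simp
    hence "\<delta> D (\<theta> D) = cl (s # w @ [\<sigma> s])"
      using step(2)[OF C(1) theta_in[OF D(1)] D(1,2)] long ws by simp
    thus False using max[OF D(1)] long by simp
  qed
  thus ?thesis by (rule folding[OF sw ws])
qed

text \<open>Words in \<open>K\<close> pass through w as words in \<sigma>(K). Walking inside the
  K-residue of \<open>C\<close>, or inside its image, therefore adjusts a distance to w0, which
  makes the two residues opposite.\<close>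

lemma max_displacement_form:
  assumes C: "C \<in> Ch" "\<delta> C (\<theta> C) = cl w"
    and max: "\<And>D. D \<in> Ch \<Longrightarrow> cox_len (\<delta> D (\<theta> D)) \<le> L w"
  defines "K \<equiv> {s. L w < L (s # w)}"
  shows "cl w = cl (longest_word K @ w0)" and "- K \<subseteq> aut_type M Ch \<delta> \<theta>"
proof -
  have conj: "cl (s # w) = cl (w @ [\<sigma> s])" if "s \<in> K" for s
    using max_displacement_conj[OF C max] that unfolding K_def by blast
  have conj_word: "cl (u @ w) = cl (w @ map \<sigma> u)" if "set u \<subseteq> K" for u
    using that
  proof (induction u)
    case (Cons s u)
    have "cl (s # u @ w) = cl (s # w @ map \<sigma> u)" using Cons by (intro cl_Cons) simp
    also have "\<dots> = cl (w @ \<sigma> s # map \<sigma> u)"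
      using cl_append[OF conj HOL.refl, of s "map \<sigma> u"] Cons.prems by simp
    finally show ?case by simp
  qed simp
  show w: "cl w = cl (longest_word K @ w0)"
  proof (rule ascents_characterise)
    show "s \<in> K \<longleftrightarrow> L w < L (s # w)" for s unfolding K_def by (rule mem_Collect_eq)
    show "\<exists>t. cl (s # w) = cl (w @ [t])" if "s \<in> K" for s using conj[OF that] by blast
  qed
  have add: "L (x @ w) = L x + L w" if "set x \<subseteq> K" for x
    by (rule L_append_longest_word_w0[OF that w])
  have kw: "cl (rev (longest_word K) @ w) = cl w0"
  proof -
    have "cl (rev (longest_word K) @ w) = cl (rev (longest_word K) @ longest_word K @ w0)" by (rule cl_append[OF HOL.refl w])
    thus ?thesis by (simp only: cl_cancel_rev_left)
  qed
  define R where "R = {D \<in> Ch. \<delta> C D \<in> cox_par M K}"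
  have R_word: "\<exists>x. set x \<subseteq> K \<and> \<delta> C D = cl x \<and> D \<in> Ch" if "D \<in> R" for D
    using that unfolding R_def cox_par_def by blast
  have R_I: "D \<in> R" if "D \<in> Ch" "\<delta> C D = cl x" "set x \<subseteq> K" for D x
    using that unfolding R_def cox_par_def by blast
  have tC: "\<theta> C \<in> Ch" by (rule theta_in[OF C(1)])
  have "opposite M \<delta> R (\<theta> ` R)"
    unfolding opposite_def cl_longest_word[symmetric]
  proof (intro conjI ballI)
    fix E assume "E \<in> R"
    then obtain x where x: "set x \<subseteq> K" "\<delta> C E = cl x" "E \<in> Ch" using R_word by blast
    have EC: "\<delta> E C = cl (rev x)" by (rule delta_sym[OF C(1) x(3,2)])
    have L: "L (rev x @ w) = L (rev x) + L w" using add[of "rev x"] x(1) by simp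
    have EtC: "\<delta> E (\<theta> C) = cl (rev x @ w)"
      by (rule delta_append[OF x(3) C(1) tC EC C(2) L])
    \<comment> \<open>Chosen so that x^-1 w \<sigma>(u) = x^-1 u w = w_K^-1 w = w0, where w_K is the
      longest element on \<open>K\<close>.\<close>
    define u where "u = x @ rev (longest_word K)"
    have u: "set u \<subseteq> K" using x(1) longest_word_subset unfolding u_def by simp
    obtain D y where D: "D \<in> Ch" "set y \<subseteq> set (map \<sigma> u)" "\<delta> (\<theta> C) D = cl y"
        "\<delta> E D = cl ((rev x @ w) @ map \<sigma> u)"
      using walk_right[OF x(3) tC EtC, of "map \<sigma> u"] by blast
    have "cl ((rev x @ w) @ map \<sigma> u) = cl (rev x @ u @ w)"
      using cl_append[OF HOL.refl conj_word[OF u], of "rev x"] by simp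
    also have "\<dots> = cl (rev x @ x @ rev (longest_word K) @ w)" unfolding u_def by simp
    also have "\<dots> = cl w0" by (simp only: cl_cancel_rev_left kw)
    finally have ED: "\<delta> E D = cl w0" using D(4) by simp
    \<comment> \<open>The chamber reached lies in the \<sigma>(K)-residue of \<theta> C; pulling
      back along \<theta> shows that it is the image of a chamber of \<open>R\<close>.\<close>
    obtain D' where D': "D' \<in> Ch" "D = \<theta> D'" using theta_surj[OF D(1)] by blast
    obtain z where z: "\<delta> C D' = cl z" using delta_word[OF C(1) D'(1)] by blast
    have "set y \<subseteq> \<sigma> ` K" using D(2) u by auto
    moreover have "cl (map \<sigma> z) = cl y"
      using delta_theta_word[OF C(1) D'(1) z] D(3) D'(2) by simp
    ultimately have "cl (map \<sigma> z) \<in> cox_par M (\<sigma> ` K)" using in_par by blast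
    hence "\<delta> C D' \<in> cox_par M K" unfolding z by (rule in_par_map)
    hence "D' \<in> R" using D'(1) unfolding R_def by simp
    thus "\<exists>D\<in>\<theta> ` R. \<delta> E D = cl w0" using ED D'(2) by blast
  next
    fix D assume "D \<in> \<theta> ` R"
    then obtain E where E: "E \<in> R" "D = \<theta> E" by blast
    obtain x where x: "set x \<subseteq> K" "\<delta> C E = cl x" "E \<in> Ch" using R_word[OF E(1)] by blast
    have D_in: "D \<in> Ch" using theta_in x(3) E(2) by simp
    have t: "\<delta> (\<theta> C) D = cl (map \<sigma> x)" using delta_theta_word[OF C(1) x(3,2)] E(2) by simp
    have "L (w @ map \<sigma> x) = L w + L (map \<sigma> x)"
      using add[OF x(1)] conj_word[OF x(1)] L_map[of x] by simp
    hence CD: "\<delta> C D = cl (x @ w)"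
      using delta_append[OF C(1) tC D_in C(2) t] conj_word[OF x(1)] by simp
    \<comment> \<open>Walking from \<open>C\<close> along this word turns the distance x w to
      \<open>D\<close> into w_K^-1 w = w0.\<close>
    define u where "u = rev (longest_word K) @ rev x"
    have u: "set u \<subseteq> K" using x(1) longest_word_subset unfolding u_def by simp
    obtain F y where F: "F \<in> Ch" "set y \<subseteq> set u" "\<delta> F C = cl y" "\<delta> F D = cl (u @ x @ w)"
      using walk[OF C(1) D_in CD, of u] by blast
    have "cl (u @ x @ w) = cl (rev (longest_word K) @ rev x @ x @ w)" unfolding u_def by simp
    also have "\<dots> = cl (rev (longest_word K) @ w)"
      by (rule cl_append[OF HOL.refl cl_cancel_rev_left])
    finally have "\<delta> F D = cl w0" using F(4) kw by simp
    hence "\<delta> D F = cl w0" using delta_sym[OF F(1) D_in] cl_rev_longest_word[of UNIV] by simp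
    moreover have "set (rev y) \<subseteq> K" using F(2) u by simp
    hence "F \<in> R" by (rule R_I[OF F(1) delta_sym[OF F(1) C(1) F(3)]])
    ultimately show "\<exists>F\<in>R. \<delta> D F = cl w0" by blast
  qed
  moreover have "simplex_of_type M Ch \<delta> (- K) R"
    unfolding simplex_of_type_def R_def using C(1) by (intro bexI[of _ C]) simp_all
  ultimately show "- K \<subseteq> aut_type M Ch \<delta> \<theta>" unfolding aut_type_def by blast
qed

text \<open>Some \<theta> E, with E in the residue of C, is at distance w0 from C. The detour
  through \<theta> C costs the displacement of C plus at most the length of the longest element on S
  - J.\<close>

lemma opposite_simplex_displacement:
  assumes "simplex_of_type M Ch \<delta> J R" "opposite M \<delta> R (\<theta> ` R)"
  shows "\<exists>C\<in>Ch. L w0 \<le> cox_len (\<delta> C (\<theta> C)) + L (longest_word (- J))"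
proof -
  obtain C where C: "C \<in> Ch" "R = {D \<in> Ch. \<delta> C D \<in> cox_par M (- J)}"
    using assms(1) unfolding simplex_of_type_def by blast
  have "\<delta> C C = cl []" using delta_one[OF C(1,1)] by simp
  hence "C \<in> R" using C by (auto simp: cox_par_def intro!: exI[of _ "[]"])
  then obtain E where E: "E \<in> R" "\<delta> C (\<theta> E) = cl w0"
    using assms(2) unfolding opposite_def cl_longest_word[symmetric] by blast
  then obtain x where x: "E \<in> Ch" "\<delta> C E = cl x" "set x \<subseteq> - J"
    unfolding C(2) by (auto simp: cox_par_def)
  obtain w where w: "\<delta> C (\<theta> C) = cl w" using delta_word[OF C(1) theta_in[OF C(1)]] by blast
  have "L w0 \<le> L w + L (map \<sigma> x)"
    using triangle[OF C(1) theta_in[OF C(1)] theta_in[OF x(1)] w delta_theta_word[OF C(1) x(1,2)]]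
      E(2) by simp
  also have "\<dots> \<le> L w + L (longest_word (- J))" using L_map[of x] longest_word_max[OF x(3)] by simp
  finally have "L w0 \<le> cox_len (\<delta> C (\<theta> C)) + L (longest_word (- J))" by (simp only: w)
  thus ?thesis using C(1) by blast
qed

text \<open>Displacements are lengths of elements of a finite group, so \<open>Max\<close> is taken
  over a finite nonempty set even when there are infinitely many chambers.\<close>

lemma displacement_le_disp: "C \<in> Ch \<Longrightarrow> cox_len (\<delta> C (\<theta> C)) \<le> disp Ch \<delta> \<theta>"
  and disp_attained: "\<exists>C\<in>Ch. cox_len (\<delta> C (\<theta> C)) = disp Ch \<delta> \<theta>"
proof -
  let ?A = "{cox_len (\<delta> C (\<theta> C)) | C. C \<in> Ch}"
  have "?A \<subseteq> cox_len ` coxW M"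
  proof
    fix n assume "n \<in> ?A"
    then obtain C where C: "C \<in> Ch" "n = cox_len (\<delta> C (\<theta> C))" by blast
    obtain w where "\<delta> C (\<theta> C) = cl w" using delta_word[OF C(1) theta_in[OF C(1)]] by blast
    thus "n \<in> cox_len ` coxW M" using C(2) by (simp add: coxW_def)
  qed
  hence fin: "finite ?A" using sph finite_subset unfolding spherical_def by blast
  show "C \<in> Ch \<Longrightarrow> cox_len (\<delta> C (\<theta> C)) \<le> disp Ch \<delta> \<theta>"
    unfolding disp_def using Max_ge[OF fin] by blast
  have "?A \<noteq> {}" using realise by blast
  hence "disp Ch \<delta> \<theta> \<in> ?A" unfolding disp_def by (rule Max_in[OF fin])
  thus "\<exists>C\<in>Ch. cox_len (\<delta> C (\<theta> C)) = disp Ch \<delta> \<theta>" by auto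
qed

text \<open>With K the ascent set, S - J lies in K, and the displacement bound makes the longest
  element on S - J at least as long as that on K. Uniqueness in the subgroup of K identifies the two
  elements without comparing K and S - J as sets.\<close>

lemma capped_max_displacement:
  assumes "capped M Ch \<delta> \<theta>" "C \<in> Ch" "cox_len (\<delta> C (\<theta> C)) = disp Ch \<delta> \<theta>"
  shows "\<delta> C (\<theta> C) = cl (longest_word (- aut_type M Ch \<delta> \<theta>) @ w0)"
proof -
  let ?J = "aut_type M Ch \<delta> \<theta>"
  obtain w where w: "\<delta> C (\<theta> C) = cl w" using delta_word[OF assms(2) theta_in[OF assms(2)]] by blast
  have max: "cox_len (\<delta> D (\<theta> D)) \<le> L w" if "D \<in> Ch" for D
    using displacement_le_disp[OF that] assms(3) w by simp
  define K where "K = {s. L w < L (s # w)}"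
  have wK: "cl w = cl (longest_word K @ w0)" "- ?J \<subseteq> K"
    using max_displacement_form[OF assms(2) w max] unfolding K_def by auto
  \<comment> \<open>Cappedness enters here: a single simplex of the full type J is opposite its
    image.\<close>
  obtain D where D: "D \<in> Ch" "L w0 \<le> cox_len (\<delta> D (\<theta> D)) + L (longest_word (- ?J))"
    using assms(1) opposite_simplex_displacement unfolding capped_def by blast
  have "L w0 \<le> L w + L (longest_word (- ?J))" using D max[OF D(1)] by linarith
  hence "L (longest_word K) \<le> L (longest_word (- ?J))" using L_append_w0[of "longest_word K"] wK(1) by simp
  moreover have "set (longest_word (- ?J)) \<subseteq> K" using longest_word_subset[of "- ?J"] wK(2) by blast
  ultimately have "cl (longest_word (- ?J)) = cl (longest_word K)"
    using maximal_word_unique[OF longest_word_subset longest_word_max] by blast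
  thus ?thesis using w wK(1) cl_append[OF _ HOL.refl, of "longest_word (- ?J)" "longest_word K" w0] by simp
qed

end

theorem theorem2p6:
  fixes M :: "'s::finite \<Rightarrow> 's \<Rightarrow> nat"
    and Ch :: "'c set" and \<delta> :: "'c \<Rightarrow> 'c \<Rightarrow> 's cox" and \<theta> :: "'c \<Rightarrow> 'c" and C :: 'c
  assumes "thick_building M Ch \<delta>"
    and "spherical M"
    and "building_aut M Ch \<delta> \<theta>"
    and "capped M Ch \<delta> \<theta>"
    and "J = aut_type M Ch \<delta> \<theta>"
    and "C \<in> Ch"
  shows "(cox_len (\<delta> C (\<theta> C)) = disp Ch \<delta> \<theta> \<longleftrightarrow>
            \<delta> C (\<theta> C) = cox_mult M (cox_longest M (- J)) (cox_longest M UNIV))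
         \<and> disp Ch \<delta> \<theta> = cox_len (cox_longest M UNIV) - cox_len (cox_longest M (- J))"
proof -
  obtain \<sigma> where \<sigma>: "bij \<sigma>" "\<forall>s t. M (\<sigma> s) (\<sigma> t) = M s t"
      "\<forall>C\<in>Ch. \<forall>D\<in>Ch. \<delta> (\<theta> C) (\<theta> D) = cox_map M \<sigma> (\<delta> C D)"
    using assms(3) unfolding building_aut_def by blast
  have bij: "bij_betw \<theta> Ch Ch" using assms(3) unfolding building_aut_def by blast
  have cox: "coxeter_matrix M"
    using assms(1) unfolding thick_building_def building_def by (elim conjE)
  interpret spherical_building_aut M Ch \<delta> \<sigma> \<theta>
    by unfold_locales (use cox assms(1,2) \<sigma> bij in auto)
  have prod: "cox_mult M (cox_longest M (- J)) (cox_longest M UNIV) = cl (longest_word (- J) @ w0)"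
    unfolding cl_longest_word[symmetric] by (rule mult_cl)
  have max_form: "\<delta> D (\<theta> D) = cl (longest_word (- J) @ w0)"
    if "D \<in> Ch" "cox_len (\<delta> D (\<theta> D)) = disp Ch \<delta> \<theta>" for D
    using capped_max_displacement[OF assms(4) that] assms(5) by simp
  \<comment> \<open>The maximum is attained at a chamber with this Weyl distance, which fixes its
    value and gives the converse half of the equivalence.\<close>
  have disp: "disp Ch \<delta> \<theta> = L (longest_word (- J) @ w0)"
    using disp_attained max_form by metis
  have "cox_len (\<delta> C (\<theta> C)) = disp Ch \<delta> \<theta> \<longleftrightarrow> \<delta> C (\<theta> C) = cl (longest_word (- J) @ w0)"
    using max_form[OF assms(6)] disp by metis
  moreover have "disp Ch \<delta> \<theta> = L w0 - L (longest_word (- J))"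
    using disp L_append_w0[of "longest_word (- J)"] by linarith
  ultimately show ?thesis by (simp add: prod cl_longest_word)
qed

end
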